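(* Let $b>1$ be an integer and let $S=S^\Box_{b,1}=(s_0,s_1,\dots)$ be any $S^\Box_{b,1}$-sequence in $[0,1)$, with initial segments $S_N=(s_0,\dots,s_{N-1})$. Let $N\in\mathbb{N}$, $n=\lfloor\log(N)/\log(b)\rfloor$, $N=\sum_{j=0}^n\epsilon_jb^j$ its base-$b$ expansion (with $\epsilon_j\in\{0,\dots,b-1\}$), and $$M_b(N)=\min\Big\{\sum_{j=0}^n\epsilon_j,\ b(n+1)-n+1-\sum_{j=0}^n\epsilon_j\Big\}.$$ Then $$N\cdot\sqrt[p]{\mathcal{D}_p(S_N)}\ \le\ \begin{cases}\sqrt[p]{\dfrac{M_b(N)}{p+1}} & \text{if } 0<p<1,\\[2ex] \dfrac{M_b(N)}{\sqrt[p]{p+1}} & \text{if } 1\le p<\infty,\end{cases}$$ and, for $p=\infty$, $N\cdot\mathcal{D}_\infty(S_N,T)\le M_b(N)$ with $T=\{[0,t]: 0<t<1\}$.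
   Context: $\mathbb{N}=\{1,2,\dots\}$. **Discrepancies on $[0,1)$** (reference measure: Lebesgue measure). For a multiset $X=\{x_1,\dots,x_N\}$ in $[0,1)$ and $0<p<\infty$, $$\mathcal{D}_p(X)=\frac1{N^p}\int_0^1\Big|\sum_{j=1}^N\chi_{[0,t)}(x_j)-Nt\Big|^p\,dt,\qquad \mathcal{D}_\infty(X,T)=\frac1N\sup_{A\in T}\Big|\sum_{j=1}^N\chi_A(x_j)-N|A|\Big|,$$ where $\chi_A$ is the indicator function of $A$ and $|A|$ its Lebesgue measure. **$S^\Box_{b,1}$-sequences.** Fix an enumeration $\{H_1,\dots,H_{b-1}\}=\{1,\dots,b-1\}$ and a sequence $\pi_0,\pi_1,\pi_2,\dots$ of permutations of $\{1,\dots,b-1\}$. Define recursively $s_0=0$ and, once $s_0,\dots,s_{b^m-1}$ are defined ($m\ge0$), $s_{k\cdot b^m+i}=b^{-m-1}H_{\pi_m(k)}+s_i$ for $1\le k\le b-1$, $0\le i<b^m$. Any sequence obtained this way is an $S^\Box_{b,1}$-sequence (these are generalized van der Corput sequences in base $b$). *)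

theory Defs
  imports "HOL-Analysis.Analysis" "HOL-Combinatorics.Permutations" "HOL-Library.Multiset"
begin

definition discrepancy :: "real \<Rightarrow> real multiset \<Rightarrow> real" where
  "discrepancy p X =
     1 / real (size X) powr p *
       (LINT t:{0..1}|lborel. \<bar>(\<Sum>x\<in>#X. indicator {0..<t} x) - real (size X) * t\<bar> powr p)"

(* Meant for nonempty families T of Borel subsets of [0,1): then the supremum is that of
   a nonempty set bounded by size X. *)
definition discrepancy_sup :: "real multiset \<Rightarrow> real set set \<Rightarrow> real" where
  "discrepancy_sup X T = 1 / real (size X) *
     (SUP A\<in>T. \<bar>(\<Sum>x\<in>#X. indicator A x) - real (size X) * measure lborel A\<bar>)"

(* Every j > 0 has exactly one representation j = k * b ^ m + i with k in {1..b - 1} and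
   i < b ^ m, so for given H and \<pi> the conditions determine exactly one sequence s. *)
definition S_box_sequence :: "nat \<Rightarrow> (nat \<Rightarrow> real) \<Rightarrow> bool" where
  "S_box_sequence b s \<longleftrightarrow>
     (\<exists>(H :: nat \<Rightarrow> nat) (\<pi> :: nat \<Rightarrow> nat \<Rightarrow> nat).
        bij_betw H {1..b - 1} {1..b - 1} \<and>
        (\<forall>m. \<pi> m permutes {1..b - 1}) \<and>
        s 0 = 0 \<and>
        (\<forall>m. \<forall>k\<in>{1..b - 1}. \<forall>i<b ^ m.
           s (k * b ^ m + i) = real (H (\<pi> m k)) / real b ^ (m + 1) + s i))"

definition initial_segment :: "(nat \<Rightarrow> real) \<Rightarrow> nat \<Rightarrow> real multiset" where
  "initial_segment s N = {# s i. i \<in># mset_set {..<N} #}"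

(* Here \<epsilon> 0, ..., \<epsilon> n are meant to be the base-b digits of a number N with leading
   position n.  The type int avoids truncated subtraction. *)
definition M_digits :: "nat \<Rightarrow> nat \<Rightarrow> (nat \<Rightarrow> nat) \<Rightarrow> int" where
  "M_digits b n \<epsilon> =
     min (\<Sum>j=0..n. int (\<epsilon> j)) (int b * (int n + 1) - int n + 1 - (\<Sum>j=0..n. int (\<epsilon> j)))"

end

theory Submission
  imports Defs
begin

text \<open>
  The local discrepancy \<open>#{i < N. s i \<le> t} - N t\<close> is additive over index intervals, so it suffices
  to cut \<open>{..<N}\<close> into few pieces whose discrepancy functions are under control. The good pieces are
  the \<open>b\<close>-adic blocks \<open>{a b\<^sup>m..<(a + 1) b\<^sup>m}\<close>: writing \<open>L = b\<^sup>m\<close>, the sequence maps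
  such a block bijectively onto a shifted lattice \<open>{c + r / L | r < L}\<close> with \<open>0 \<le> c < 1 / L\<close>,
  because the low \<open>m\<close> digits of the index run through all values and the high digits only contribute the
  constant \<open>c\<close> (\<open>local_disc_block\<close>). The discrepancy function of a shifted lattice is a sawtooth
  with values in \<open>[- 1, 1]\<close>, and with \<open>y = L c\<close> the integral of its \<open>p\<close>-th absolute power is
  \<open>(y\<^bsup>p+1\<^esup> + (1 - y)\<^bsup>p+1\<^esup>) / (p + 1) \<le> 1 / (p + 1)\<close>
  (\<open>lattice_disc_integral\<close>). Functions with these bounds are called waves.

  There are two ways to express the discrepancy of \<open>{..<N}\<close> by waves, and they give the two terms of the
  minimum. Reading the expansion of \<open>N\<close> from the leading digit cuts \<open>{..<N}\<close> into
  \<open>\<Sum>\<epsilon>\<^sub>j\<close> blocks. Alternatively, \<open>{..<N}\<close> is the single block \<open>{..<b\<^bsup>n+1\<^esup>}\<close> without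
  its part from \<open>N\<close> on; since \<open>b\<^bsup>n+1\<^esup> - N = 1 + \<Sum>(b - 1 - \<epsilon>\<^sub>j) b\<^sup>j\<close>, that part consists
  of \<open>1 + \<Sum>(b - 1 - \<epsilon>\<^sub>j)\<close> blocks, and minus a wave is again a wave. This makes
  \<open>2 + \<Sum>(b - 1 - \<epsilon>\<^sub>j)\<close> waves, which is the second term (\<open>wave_sum_initial_segment\<close>).

  A sum of \<open>k\<close> waves is bounded by \<open>k\<close>, which is the claim for the supremum. The integral of its
  \<open>p\<close>-th absolute power is at most \<open>k / (p + 1)\<close> for \<open>p \<le> 1\<close>, by subadditivity of
  \<open>x \<mapsto> x\<^sup>p\<close>, and at most \<open>k\<^sup>p / (p + 1)\<close> for \<open>p \<ge> 1\<close>, by its convexity.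
\<close>

section \<open>Waves and their sums\<close>

text \<open>
  The bounds are those shared by the discrepancy functions of all shifted lattices. They hold for every
  exponent at once, so that one decomposition into waves serves all \<open>p\<close> and the supremum.
\<close>

definition wave :: "(real \<Rightarrow> real) \<Rightarrow> bool" where
  "wave g \<longleftrightarrow> g \<in> borel_measurable borel \<and> (\<forall>t\<in>{0..1}. \<bar>g t\<bar> \<le> 1) \<and>
     (\<forall>p>0. (LINT t:{0..1}|lborel. \<bar>g t\<bar> powr p) \<le> 1 / (p + 1))"

inductive wave_sum :: "nat \<Rightarrow> (real \<Rightarrow> real) \<Rightarrow> bool" where
  wave_sum_0: "wave_sum 0 (\<lambda>t. 0)"
| wave_sum_Suc: "wave_sum k F \<Longrightarrow> wave g \<Longrightarrow> wave_sum (Suc k) (\<lambda>t. F t + g t)"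

lemma wave_uminus: "wave g \<Longrightarrow> wave (\<lambda>t. - g t)"
  by (simp add: wave_def)

lemma wave_imp_wave_sum: "wave g \<Longrightarrow> wave_sum 1 g"
  using wave_sum_Suc[OF wave_sum_0] by simp

lemma wave_sum_add:
  assumes "wave_sum k F" "wave_sum l G"
  shows "wave_sum (k + l) (\<lambda>t. F t + G t)"
  using assms(2)
proof (induction rule: wave_sum.induct)
  case wave_sum_0
  show ?case using assms(1) by simp
next
  case (wave_sum_Suc l G g)
  from wave_sum.wave_sum_Suc[OF wave_sum_Suc(3,2)] show ?case by (simp add: add.assoc)
qed

lemma wave_sum_uminus: "wave_sum k F \<Longrightarrow> wave_sum k (\<lambda>t. - F t)"
proof (induction rule: wave_sum.induct)
  case wave_sum_0
  show ?case using wave_sum.wave_sum_0 by simp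
next
  case (wave_sum_Suc k F g)
  from wave_sum.wave_sum_Suc[OF wave_sum_Suc(3) wave_uminus[OF wave_sum_Suc(2)]]
  show ?case by simp
qed

lemma wave_sum_measurable: "wave_sum k F \<Longrightarrow> F \<in> borel_measurable borel"
  by (induction rule: wave_sum.induct) (auto simp: wave_def)

lemma wave_sum_bound:
  assumes "wave_sum k F" "t \<in> {0..1}"
  shows "\<bar>F t\<bar> \<le> real k"
  using assms
proof (induction rule: wave_sum.induct)
  case (wave_sum_Suc k F g)
  have "\<bar>F t + g t\<bar> \<le> \<bar>F t\<bar> + \<bar>g t\<bar>" by (rule abs_triangle_ineq)
  moreover have "\<bar>g t\<bar> \<le> 1" using wave_sum_Suc by (auto simp: wave_def)
  ultimately show ?case using wave_sum_Suc by auto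
qed simp

lemma set_integrable_bounded_powr:
  fixes g :: "real \<Rightarrow> real"
  assumes "g \<in> borel_measurable borel" "\<And>t. t \<in> {0..1} \<Longrightarrow> \<bar>g t\<bar> \<le> B" "p > 0"
  shows "set_integrable lborel {0..1} (\<lambda>t. \<bar>g t\<bar> powr p)"
  unfolding set_integrable_def
proof (rule integrableI_bounded_set_indicator[where B = "B powr p"])
  show "AE t in lborel. t \<in> {0..1} \<longrightarrow> norm (\<bar>g t\<bar> powr p) \<le> B powr p"
    using assms by (intro AE_I2) (auto intro!: powr_mono2)
qed (use assms(1) in auto)

lemma wave_sum_integrable:
  "wave_sum k F \<Longrightarrow> p > 0 \<Longrightarrow> set_integrable lborel {0..1} (\<lambda>t. \<bar>F t\<bar> powr p)"
  by (rule set_integrable_bounded_powr[OF wave_sum_measurable wave_sum_bound])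

text \<open>
  With \<open>z = \<bar>x\<bar> + \<bar>y\<bar>\<close>, the fractions \<open>\<bar>x\<bar> / z\<close> and \<open>\<bar>y\<bar> / z\<close> add up to 1,
  and each only grows when it is raised to a power \<open>p \<le> 1\<close>.
\<close>

lemma powr_abs_add_le_concave:
  fixes x y p :: real
  assumes "0 < p" "p \<le> 1"
  shows "\<bar>x + y\<bar> powr p \<le> \<bar>x\<bar> powr p + \<bar>y\<bar> powr p"
proof (cases "x = 0 \<and> y = 0")
  case False
  define z where "z = \<bar>x\<bar> + \<bar>y\<bar>"
  have z: "z > 0" using False by (auto simp: z_def)
  have part: "u / z * z powr p \<le> u powr p" if "0 \<le> u" "u \<le> z" for u
  proof -
    have "u / z = (u / z) powr 1" using that z by auto
    also have "\<dots> \<le> (u / z) powr p" using assms that z by (intro powr_mono') auto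
    finally have "u / z * z powr p \<le> (u / z) powr p * z powr p"
      by (intro mult_right_mono) auto
    then show ?thesis using that z by (simp add: powr_divide)
  qed
  have "\<bar>x + y\<bar> powr p \<le> z powr p"
    using assms by (intro powr_mono2) (auto simp: z_def)
  also have "\<dots> = (\<bar>x\<bar> / z + \<bar>y\<bar> / z) * z powr p"
    using z by (simp add: z_def flip: add_divide_distrib)
  also have "\<dots> \<le> \<bar>x\<bar> powr p + \<bar>y\<bar> powr p"
    using part[of "\<bar>x\<bar>"] part[of "\<bar>y\<bar>"] by (simp add: z_def distrib_right)
  finally show ?thesis .
qed (use assms in auto)

text \<open>
  Convexity of \<open>x \<mapsto> x\<^sup>p\<close>, applied to \<open>\<bar>x\<bar> / a\<close> and \<open>\<bar>y\<bar> / b\<close> with weights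
  \<open>a / (a + b)\<close> and \<open>b / (a + b)\<close>. If \<open>a\<close> and \<open>b\<close> are the sizes allowed for \<open>x\<close> and
  \<open>y\<close>, the estimate loses nothing when both attain them; it plays the part of Minkowski's inequality.
\<close>

lemma powr_abs_add_le_convex:
  fixes x y p a b :: real
  assumes "p \<ge> 1" "a > 0" "b > 0"
  shows "\<bar>x + y\<bar> powr p \<le>
    (a + b) powr (p - 1) * (\<bar>x\<bar> powr p / a powr (p - 1) + \<bar>y\<bar> powr p / b powr (p - 1))"
proof -
  have peel: "w powr p = w powr (p - 1) * w" if "w > 0" for w
    using that by (simp add: powr_diff)
  have cancel: "C * s * (a / s * (X / (A * a)) + b / s * (Y / (B * b))) = C * (X / A + Y / B)"
    if "s \<noteq> 0" "a \<noteq> 0" "b \<noteq> 0" for s a b A B C X Y :: real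
    using that by (cases "C = 0") (simp_all add: distrib_left)
  have single: "l * w powr p \<ge> (l * w) powr p" if "0 \<le> w" "0 < l" "l \<le> 1" for l w :: real
  proof -
    have "l powr p \<le> l powr 1" using assms(1) that by (intro powr_mono') auto
    then show ?thesis using that by (simp add: powr_mult mult_right_mono)
  qed
  \<comment> \<open>The convexity fact covers positive arguments only; \<open>single\<close> takes care of zero.\<close>
  have convex: "(a / (a + b) * u + b / (a + b) * v) powr p
      \<le> a / (a + b) * u powr p + b / (a + b) * v powr p" if "0 \<le> u" "0 \<le> v" for u v
  proof (cases "u = 0 \<or> v = 0")
    case True
    then show ?thesis
      using single[of u "a / (a + b)"] single[of v "b / (a + b)"] that assms by auto
  next
    case False
    have "1 - b / (a + b) = a / (a + b)" using assms by (simp add: field_simps)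
    with convex_onD[OF powr_convex[OF assms(1)], of "b / (a + b)" u v] False that assms
    show ?thesis by (simp add: field_simps)
  qed
  have "\<bar>x + y\<bar> powr p \<le> (\<bar>x\<bar> + \<bar>y\<bar>) powr p"
    using assms by (intro powr_mono2) auto
  also have "\<dots> = (a + b) powr p * (a / (a + b) * (\<bar>x\<bar> / a) + b / (a + b) * (\<bar>y\<bar> / b)) powr p"
    using assms by (simp add: powr_divide flip: add_divide_distrib)
  also have "\<dots> \<le> (a + b) powr p * (a / (a + b) * (\<bar>x\<bar> / a) powr p + b / (a + b) * (\<bar>y\<bar> / b) powr p)"
    using assms by (intro mult_left_mono convex) auto
  also have "\<dots> = (a + b) powr (p - 1) * (\<bar>x\<bar> powr p / a powr (p - 1) + \<bar>y\<bar> powr p / b powr (p - 1))"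
    using cancel[of "a + b" a b] assms(2,3)
    by (simp only: powr_divide peel[of a] peel[of b] peel[of "a + b"] add_pos_pos
        less_imp_neq[symmetric] not_False_eq_True abs_ge_zero less_imp_le simp_thms)
  finally show ?thesis .
qed

lemma wave_sum_integral_concave:
  assumes "wave_sum k F" "0 < p" "p \<le> 1"
  shows "(LINT t:{0..1}|lborel. \<bar>F t\<bar> powr p) \<le> real k / (p + 1)"
  using assms(1)
proof (induction rule: wave_sum.induct)
  case wave_sum_0
  show ?case by (simp add: set_lebesgue_integral_def)
next
  case (wave_sum_Suc k F g)
  note int = wave_sum_integrable[OF wave_sum_Suc(1) assms(2)]
    wave_sum_integrable[OF wave_imp_wave_sum[OF wave_sum_Suc(2)] assms(2)]
    wave_sum_integrable[OF wave_sum.wave_sum_Suc[OF wave_sum_Suc(1,2)] assms(2)]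
  have "(LINT t:{0..1}|lborel. \<bar>F t + g t\<bar> powr p)
      \<le> (LINT t:{0..1}|lborel. \<bar>F t\<bar> powr p + \<bar>g t\<bar> powr p)"
    using int assms(2,3) by (intro set_integral_mono set_integral_add powr_abs_add_le_concave)
  also have "\<dots> = (LINT t:{0..1}|lborel. \<bar>F t\<bar> powr p) + (LINT t:{0..1}|lborel. \<bar>g t\<bar> powr p)"
    using int by (intro set_integral_add)
  also have "\<dots> \<le> real k / (p + 1) + 1 / (p + 1)"
    using wave_sum_Suc assms(2) by (intro add_mono) (auto simp: wave_def)
  finally show ?case by (simp add: add_divide_distrib add.commute)
qed

text \<open>
  In the induction step, a sum of \<open>k\<close> waves is weighted with \<open>k\<close> and the additional wave with 1.
  Then both terms of the convexity estimate are proportional to their weights, and the bound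
  \<open>(k + 1)\<^sup>p / (p + 1)\<close> is reproduced.
\<close>

lemma wave_sum_integral_convex:
  assumes "wave_sum k F" "1 \<le> p"
  shows "(LINT t:{0..1}|lborel. \<bar>F t\<bar> powr p) \<le> real k powr p / (p + 1)"
  using assms(1)
proof (induction rule: wave_sum.induct)
  case wave_sum_0
  show ?case by (simp add: set_lebesgue_integral_def)
next
  case (wave_sum_Suc k F g)
  have p: "p > 0" using assms(2) by simp
  note int = wave_sum_integrable[OF wave_sum_Suc(1) p]
    wave_sum_integrable[OF wave_imp_wave_sum[OF wave_sum_Suc(2)] p]
    wave_sum_integrable[OF wave_sum.wave_sum_Suc[OF wave_sum_Suc(1,2)] p]
  have g: "(LINT t:{0..1}|lborel. \<bar>g t\<bar> powr p) \<le> 1 / (p + 1)"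
    using wave_sum_Suc(2) p by (auto simp: wave_def)
  show ?case
  proof (cases "k = 0")
    case True
    have "(LINT t:{0..1}|lborel. \<bar>F t + g t\<bar> powr p) = (LINT t:{0..1}|lborel. \<bar>g t\<bar> powr p)"
      using wave_sum_bound[OF wave_sum_Suc(1)] True
      by (intro set_lebesgue_integral_cong) auto
    with g True show ?thesis by simp
  next
    case False
    define C where "C = real (k + 1) powr (p - 1)"
    define c where "c = real k powr (p - 1)"
    have c: "c > 0" "C \<ge> 0" using False by (auto simp: c_def C_def)
    have "(LINT t:{0..1}|lborel. \<bar>F t + g t\<bar> powr p)
        \<le> (LINT t:{0..1}|lborel. C / c * \<bar>F t\<bar> powr p + C * \<bar>g t\<bar> powr p)"
    proof (intro set_integral_mono set_integral_add set_integrable_mult_right int)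
      fix t
      show "\<bar>F t + g t\<bar> powr p \<le> C / c * \<bar>F t\<bar> powr p + C * \<bar>g t\<bar> powr p"
        using powr_abs_add_le_convex[OF assms(2), of "real k" 1 "F t" "g t"] False
        by (simp add: C_def c_def distrib_left add.commute)
    qed
    also have "\<dots> = C / c * (LINT t:{0..1}|lborel. \<bar>F t\<bar> powr p)
        + C * (LINT t:{0..1}|lborel. \<bar>g t\<bar> powr p)"
      using int by (simp add: set_integral_add)
    also have "\<dots> \<le> C / c * (real k powr p / (p + 1)) + C * (1 / (p + 1))"
      using wave_sum_Suc(3) g c by (intro add_mono mult_left_mono) auto
    also have "\<dots> = real (Suc k) powr p / (p + 1)"
    proof -
      have "real k powr p = c * real k" "real (Suc k) powr p = C * real (Suc k)"
        using False by (simp_all add: C_def c_def powr_diff)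
      then show ?thesis using c by (simp add: distrib_left add_divide_distrib)
    qed
    finally show ?thesis .
  qed
qed

section \<open>Shifted lattices\<close>

definition lattice_disc :: "nat \<Rightarrow> real \<Rightarrow> real \<Rightarrow> real" where
  "lattice_disc L c t = (\<Sum>r<L. of_bool (c + real r / real L \<le> t) - t)"

text \<open>
  For \<open>t\<close> in the cell \<open>[R / L, (R + 1) / L)\<close> the lattice points in the earlier cells are all counted
  and those in the later cells are not; only the point in the cell of \<open>t\<close> itself depends on \<open>t\<close>.
  As a consequence the function is a sawtooth of slope \<open>- L\<close>.
\<close>

lemma lattice_disc_on_cell:
  assumes "R < L" "0 \<le> c" "c < 1 / real L" "real R \<le> real L * t" "real L * t < real R + 1"
  shows "lattice_disc L c t = of_bool (c + real R / real L \<le> t) - (real L * t - real R)"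
proof -
  let ?d = "of_bool (c + real R / real L \<le> t) :: real"
  have L: "real L > 0" using assms(1) by simp
  have count: "of_bool (c + real r / real L \<le> t) = of_bool (r < R) + (if r = R then ?d else 0)" for r
  proof (cases r R rule: linorder_cases)
    case less
    then have "real r + 1 \<le> real R" by linarith
    have "real L * c < 1" using assms(3) L by (simp add: field_simps)
    then have "real L * c + real r \<le> real L * t" using \<open>real r + 1 \<le> real R\<close> assms(4) by linarith
    then have "c + real r / real L \<le> t" using L by (simp add: field_simps)
    with less show ?thesis by simp
  next
    case greater
    then have "real R + 1 \<le> real r" by linarith
    then have "real L * t < real L * c + real r" using assms(2,5) L mult_nonneg_nonneg[of "real L" c] by linarith
    then have "\<not> c + real r / real L \<le> t" using L by (simp add: field_simps)
    with greater show ?thesis by simp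
  qed simp
  have "(\<Sum>r<L. of_bool (r < R) :: real) = real R"
  proof -
    have "{r. r < L \<and> r < R} = {..<R}" using assms(1) by auto
    then show ?thesis by (simp add: of_bool_def sum.If_cases Int_def)
  qed
  moreover have "(\<Sum>r<L. of_bool (c + real r / real L \<le> t)) = (\<Sum>r<L. of_bool (r < R) + (if r = R then ?d else 0))"
    by (intro sum.cong refl count)
  ultimately show ?thesis
    using assms(1) by (simp add: lattice_disc_def sum_subtractf sum.distrib)
qed

lemma lattice_disc_at_1:
  assumes "0 \<le> c" "c < 1 / real L"
  shows "lattice_disc L c 1 = 0"
proof -
  have "c + real r / real L \<le> 1" if "r < L" for r
  proof -
    have "real r + 1 \<le> real L" using that by linarith
    then have "1 / real L + real r / real L \<le> 1" using that by (simp flip: add_divide_distrib)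
    with assms(2) show ?thesis by linarith
  qed
  then show ?thesis by (simp add: lattice_disc_def)
qed

text \<open>
  The base of the power vanishes at one end of the interval, where the derivative rule for powers with a positive
  base does not apply; hence the version of the fundamental theorem for derivatives in the interior.
\<close>

lemma has_integral_powr_increasing:
  fixes a b L q p :: real
  assumes "a \<le> b" "L > 0" "p > 0" "L * a = q"
  shows "((\<lambda>t. (L * t - q) powr p) has_integral (L * b - q) powr (p + 1) / (L * (p + 1))) {a..b}"
proof -
  have nonneg: "L * t - q \<ge> 0" if "t \<ge> a" for t
    using mult_left_mono[OF that, of L] assms by simp
  have "((\<lambda>t. (L * t - q) powr p) has_integral
      ((L * b - q) powr (p + 1) / (L * (p + 1)) - (L * a - q) powr (p + 1) / (L * (p + 1)))) {a..b}"
  proof (rule fundamental_theorem_of_calculus_interior)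
    show "continuous_on {a..b} (\<lambda>t. (L * t - q) powr (p + 1) / (L * (p + 1)))"
      using assms nonneg by (intro continuous_intros continuous_on_powr') auto
    fix t assume t: "t \<in> {a<..<b}"
    have "L * t - q > 0" using t assms mult_strict_left_mono[of a t L] by simp
    then show "((\<lambda>t. (L * t - q) powr (p + 1) / (L * (p + 1))) has_vector_derivative (L * t - q) powr p) (at t)"
    proof -
      have "((\<lambda>t. (L * t - q) powr (p + 1)) has_real_derivative (L * (p + 1)) * (L * t - q) powr p) (at t)"
        using \<open>L * t - q > 0\<close> by (auto intro!: derivative_eq_intros)
      from DERIV_cdivide[OF this, of "L * (p + 1)"] show ?thesis
        using assms by (simp flip: has_real_derivative_iff_has_vector_derivative)
    qed
  qed (use assms in auto)
  then show ?thesis using assms by simp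
qed

lemma has_integral_powr_decreasing:
  fixes a b L q p :: real
  assumes "a \<le> b" "L > 0" "p > 0" "L * b = q"
  shows "((\<lambda>t. (q - L * t) powr p) has_integral (q - L * a) powr (p + 1) / (L * (p + 1))) {a..b}"
proof -
  have "((\<lambda>t. (L * t - (- q)) powr p) has_integral (L * (- a) - (- q)) powr (p + 1) / (L * (p + 1))) {- b..- a}"
    using assms by (intro has_integral_powr_increasing) auto
  then show ?thesis
    by (subst has_integral_reflect_real[symmetric]) (simp add: add.commute)
qed

text \<open>
  On a cell, the absolute value of the sawtooth rises linearly from 0 to \<open>L c\<close>, jumps to
  \<open>1 - L c\<close> at the lattice point, and falls linearly to 0. At the lattice point and at the
  right end of the cell the values need not follow these formulas, but finitely many points do not affect
  the integral.
\<close>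

lemma lattice_disc_integral_on_cell:
  assumes "R < L" "0 \<le> c" "c < 1 / real L" "p > 0"
  shows "((\<lambda>t. \<bar>lattice_disc L c t\<bar> powr p) has_integral
    ((real L * c) powr (p + 1) + (1 - real L * c) powr (p + 1)) / (real L * (p + 1)))
    {real R / real L..real (Suc R) / real L}"
proof -
  let ?x = "c + real R / real L"
  have L: "real L > 0" using assms(1) by simp
  have Lx: "real L * ?x = real L * c + real R" using L by (simp add: distrib_left)
  have Lc: "0 \<le> real L * c" "real L * c < 1" using assms L by (simp_all add: field_simps)
  have order: "real R / real L \<le> ?x" "?x \<le> real (Suc R) / real L"
    using assms by (simp_all add: add_divide_distrib)
  have cell: "lattice_disc L c t = of_bool (?x \<le> t) - (real L * t - real R)"
    if "real R / real L \<le> t" "t < real (Suc R) / real L" for t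
    using lattice_disc_on_cell[OF assms(1-3), of t] that L by (simp add: field_simps)
  have "((\<lambda>t. (real L * t - real R) powr p) has_integral
      (real L * ?x - real R) powr (p + 1) / (real L * (p + 1))) {real R / real L..?x}"
    using order L assms by (intro has_integral_powr_increasing) auto
  moreover have "real L * ?x - real R = real L * c" by (simp add: Lx)
  ultimately have "((\<lambda>t. (real L * t - real R) powr p) has_integral
      (real L * c) powr (p + 1) / (real L * (p + 1))) {real R / real L..?x}" by (simp only:)
  then have left: "((\<lambda>t. \<bar>lattice_disc L c t\<bar> powr p) has_integral
      (real L * c) powr (p + 1) / (real L * (p + 1))) {real R / real L..?x}"
  proof (rule has_integral_spike_finite[rotated 2, of _ _ _ "{?x}"])
    fix t assume t: "t \<in> {real R / real L..?x} - {?x}"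
    then have "real L * t - real R \<ge> 0" using L by (simp add: field_simps)
    with cell[of t] t order show "\<bar>lattice_disc L c t\<bar> powr p = (real L * t - real R) powr p"
      by simp
  qed simp
  have "((\<lambda>t. (real (Suc R) - real L * t) powr p) has_integral
      (real (Suc R) - real L * ?x) powr (p + 1) / (real L * (p + 1))) {?x..real (Suc R) / real L}"
    using order L assms by (intro has_integral_powr_decreasing) auto
  moreover have "real (Suc R) - real L * ?x = 1 - real L * c" by (simp add: Lx)
  ultimately have "((\<lambda>t. (real (Suc R) - real L * t) powr p) has_integral
      (1 - real L * c) powr (p + 1) / (real L * (p + 1))) {?x..real (Suc R) / real L}" by (simp only:)
  then have right: "((\<lambda>t. \<bar>lattice_disc L c t\<bar> powr p) has_integral
      (1 - real L * c) powr (p + 1) / (real L * (p + 1))) {?x..real (Suc R) / real L}"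
  proof (rule has_integral_spike_finite[rotated 2, of _ _ _ "{real (Suc R) / real L}"])
    fix t assume t: "t \<in> {?x..real (Suc R) / real L} - {real (Suc R) / real L}"
    then have "t < real (Suc R) / real L" by auto
    then have "real L * t \<le> real (Suc R)" using L by (simp add: field_simps)
    moreover have "lattice_disc L c t = real (Suc R) - real L * t"
      using cell[of t] t order \<open>t < _\<close> by simp
    ultimately show "\<bar>lattice_disc L c t\<bar> powr p = (real (Suc R) - real L * t) powr p"
      by simp
  qed simp
  from has_integral_combine[OF order left right] show ?thesis
    by (simp add: add_divide_distrib)
qed

lemma lattice_disc_integral:
  assumes "L > 0" "0 \<le> c" "c < 1 / real L" "p > 0"
  shows "((\<lambda>t. \<bar>lattice_disc L c t\<bar> powr p) has_integral
    ((real L * c) powr (p + 1) + (1 - real L * c) powr (p + 1)) / (p + 1)) {0..1}"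
proof -
  define I where "I = ((real L * c) powr (p + 1) + (1 - real L * c) powr (p + 1)) / (real L * (p + 1))"
  have "((\<lambda>t. \<bar>lattice_disc L c t\<bar> powr p) has_integral real R * I) {0..real R / real L}"
    if "R \<le> L" for R
    using that
  proof (induction R)
    case 0
    show ?case using has_integral_refl by simp
  next
    case (Suc R)
    have "((\<lambda>t. \<bar>lattice_disc L c t\<bar> powr p) has_integral real R * I + I) {0..real (Suc R) / real L}"
    proof (rule has_integral_combine)
      show "((\<lambda>t. \<bar>lattice_disc L c t\<bar> powr p) has_integral I) {real R / real L..real (Suc R) / real L}"
        unfolding I_def using Suc.prems assms by (intro lattice_disc_integral_on_cell) auto
    qed (use Suc in \<open>auto simp: divide_right_mono\<close>)
    then show ?case by (simp add: distrib_right add.commute)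
  qed
  from this[of L] show ?thesis using assms(1) by (simp add: I_def)
qed

text \<open>
  The integral is largest when the shift puts the lattice points at the left ends of the cells, because
  \<open>y\<^bsup>p+1\<^esup> + (1 - y)\<^bsup>p+1\<^esup> \<le> y + (1 - y)\<close>.
\<close>

lemma wave_lattice_disc:
  assumes "L > 0" "0 \<le> c" "c < 1 / real L"
  shows "wave (lattice_disc L c)"
proof -
  have meas: "lattice_disc L c \<in> borel_measurable borel"
    unfolding lattice_disc_def by measurable
  have L: "real L > 0" using assms(1) by simp
  have bound: "\<bar>lattice_disc L c t\<bar> \<le> 1" if "t \<in> {0..1}" for t
  proof (cases "t = 1")
    case False
    define R where "R = nat \<lfloor>real L * t\<rfloor>"
    have R: "real R \<le> real L * t" "real L * t < real R + 1"
      using that L by (simp_all add: R_def)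
    have "real L * t < real L * 1" using that False L by (intro mult_strict_left_mono) auto
    with R have "R < L" by linarith
    from lattice_disc_on_cell[OF this assms(2,3) R] R show ?thesis by auto
  qed (use lattice_disc_at_1[OF assms(2,3)] in simp)
  have "(LINT t:{0..1}|lborel. \<bar>lattice_disc L c t\<bar> powr p) \<le> 1 / (p + 1)" if "p > 0" for p
  proof -
    have Lc: "0 \<le> real L * c" "real L * c < 1" using assms L by (simp_all add: field_simps)
    have "(LINT t:{0..1}|lborel. \<bar>lattice_disc L c t\<bar> powr p)
        = integral {0..1} (\<lambda>t. \<bar>lattice_disc L c t\<bar> powr p)"
      using meas bound that by (intro set_borel_integral_eq_integral set_integrable_bounded_powr)
    also have "\<dots> = ((real L * c) powr (p + 1) + (1 - real L * c) powr (p + 1)) / (p + 1)"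
      by (rule integral_unique[OF lattice_disc_integral[OF assms that]])
    also have "\<dots> \<le> ((real L * c) powr 1 + (1 - real L * c) powr 1) / (p + 1)"
      using Lc that by (intro divide_right_mono add_mono powr_mono') auto
    also have "\<dots> = 1 / (p + 1)" using Lc by simp
    finally show ?thesis .
  qed
  with meas bound show ?thesis by (auto simp: wave_def)
qed

section \<open>Blocks of the sequence\<close>

text \<open>
  The intervals \<open>[0, t]\<close> are closed here, as in the supremum. The \<open>L\<^sub>p\<close> discrepancy uses
  \<open>[0, t)\<close>, which makes a difference for finitely many \<open>t\<close> only.
\<close>

definition local_disc :: "(nat \<Rightarrow> real) \<Rightarrow> nat set \<Rightarrow> real \<Rightarrow> real" where
  "local_disc s A t = (\<Sum>i\<in>A. of_bool (s i \<le> t) - t)"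

text \<open>
  The value at an index is obtained by permuting its \<open>m\<close>-th digit with \<open>\<sigma> m\<close>, for every \<open>m\<close>, and
  reflecting the digits at the radix point. Admitting the leading digit 0 in \<open>step\<close>, which
  forces \<open>\<sigma> m 0 = 0\<close>, lets \<open>k * b ^ m + i\<close> range over all indices below \<open>b ^ Suc m\<close>.
\<close>

locale digit_permuted_sequence =
  fixes b :: nat and s :: "nat \<Rightarrow> real" and \<sigma> :: "nat \<Rightarrow> nat \<Rightarrow> nat"
  assumes base: "b > 1"
    and digit_bij: "bij_betw (\<sigma> m) {..<b} {..<b}"
    and start: "s 0 = 0"
    and step: "k < b \<Longrightarrow> i < b ^ m \<Longrightarrow> s (k * b ^ m + i) = real (\<sigma> m k) / real b ^ (m + 1) + s i"
begin

lemma leading_digit: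
  assumes "a < b ^ Suc q"
  obtains k a' where "a = k * b ^ q + a'" "k < b" "a' < b ^ q"
proof
  show "a = a div b ^ q * b ^ q + a mod b ^ q" by (rule div_mult_mod_eq[symmetric])
  show "a div b ^ q < b" using assms base by (simp add: less_mult_imp_div_less)
  show "a mod b ^ q < b ^ q" using base by simp
qed

text \<open>
  Removing the leading digit \<open>k\<close> of the block number \<open>k * b ^ q + a'\<close> changes all values in the block by the
  same amount. This is what makes inductions on the number of digits of the block number work.
\<close>

lemma step_block_start:
  assumes "k < b" "a' < b ^ q" "i < b ^ m"
  shows "s ((k * b ^ q + a') * b ^ m + i) = real (\<sigma> (m + q) k) / real b ^ (m + q + 1) + s (a' * b ^ m + i)"
proof -
  have "a' * b ^ m + i < (a' + 1) * b ^ m" using assms by simp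
  also have "\<dots> \<le> b ^ q * b ^ m" using assms by (intro mult_right_mono) auto
  finally have "a' * b ^ m + i < b ^ (m + q)" by (simp add: power_add mult.commute)
  from step[OF assms(1) this] show ?thesis by (simp add: algebra_simps power_add)
qed

lemma block_translate:
  assumes "i < b ^ m"
  shows "s (a * b ^ m + i) = s (a * b ^ m) + s i"
proof -
  have "s (a * b ^ m + i) = s (a * b ^ m) + s i" if "a < b ^ q" for q
    using that
  proof (induction q arbitrary: a)
    case 0
    then show ?case using start by simp
  next
    case (Suc q)
    obtain k a' where a: "a = k * b ^ q + a'" "k < b" "a' < b ^ q"
      using leading_digit[OF Suc.prems] by blast
    show ?case
      using step_block_start[OF a(2,3) assms] step_block_start[OF a(2,3), of 0 m] Suc.IH[OF a(3)] base
      by (simp add: a(1))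
  qed
  from this[OF power_gt_expt] show ?thesis using base by simp
qed

text \<open>
  The first index of a block has its lowest \<open>m\<close> digits equal to 0, so that its value has only zeros among the
  first \<open>m\<close> digits after the radix point. The induction needs the sharp bound
  \<open>1 / b\<^sup>m - 1 / b\<^bsup>m+q\<^esup>\<close> for block numbers with \<open>q\<close> digits.
\<close>

lemma block_start_bounds: "0 \<le> s (a * b ^ m)" "s (a * b ^ m) < 1 / real b ^ m"
proof -
  have bounds: "0 \<le> s (a * b ^ m) \<and> s (a * b ^ m) \<le> 1 / real b ^ m - 1 / real b ^ (m + q)"
    if "a < b ^ q" for q
    using that
  proof (induction q arbitrary: a)
    case 0
    then show ?case using start by simp
  next
    case (Suc q)
    obtain k a' where a: "a = k * b ^ q + a'" "k < b" "a' < b ^ q"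
      using leading_digit[OF Suc.prems] by blast
    let ?d = "\<sigma> (m + q) k"
    have "?d < b" using digit_bij[of "m + q"] a(2) by (auto simp: bij_betw_def)
    then have "real ?d / real b ^ (m + q + 1) \<le> (real b - 1) / real b ^ (m + q + 1)"
      using base by (intro divide_right_mono) auto
    also have "\<dots> = 1 / real b ^ (m + q) - 1 / real b ^ (m + Suc q)"
      using base by (simp add: field_simps)
    finally show ?case
      using step_block_start[OF a(2,3), of 0 m] Suc.IH[OF a(3)] base by (simp add: a(1))
  qed
  have "a < b ^ a" using base by (intro power_gt_expt) simp
  moreover have "1 / real b ^ (m + a) > 0" using base by simp
  ultimately show "0 \<le> s (a * b ^ m)" "s (a * b ^ m) < 1 / real b ^ m"
    using bounds[of a] by linarith+
qed

text \<open>
  The first \<open>b ^ m\<close> values are exactly the multiples of \<open>1 / b ^ m\<close> in \<open>[0, 1)\<close>. Stated for sums, this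
  avoids handling the bijection itself: in the induction step the leading digit of the index is the lowest digit
  of the numerator, and its permutation \<open>\<sigma> m\<close> only reorders the sum.
\<close>

lemma sum_initial_block:
  fixes f :: "real \<Rightarrow> real"
  shows "(\<Sum>i<b ^ m. f (s i)) = (\<Sum>r<b ^ m. f (real r / real b ^ m))"
proof (induction m arbitrary: f)
  case 0
  show ?case using start by simp
next
  case (Suc m)
  have shift: "(\<Sum>i\<in>{k * n..<k * n + n}. h i) = (\<Sum>i<n. h (k * n + i))"
    for h :: "nat \<Rightarrow> real" and k n
    using sum.shift_bounds_nat_ivl[of h 0 "k * n" n] by (simp add: atLeast0LessThan add.commute)
  have "(\<Sum>i<b ^ Suc m. f (s i)) = (\<Sum>k<b. \<Sum>i<b ^ m. f (s (k * b ^ m + i)))"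
    by (simp add: shift flip: sum.nat_group)
  also have "\<dots> = (\<Sum>k<b. \<Sum>i<b ^ m. f (real (\<sigma> m k) / real b ^ (m + 1) + s i))"
    by (intro sum.cong) (auto simp: step)
  also have "\<dots> = (\<Sum>k<b. \<Sum>r<b ^ m. f (real (\<sigma> m k) / real b ^ (m + 1) + real r / real b ^ m))"
    using Suc.IH[of "\<lambda>x. f (real (\<sigma> m _) / real b ^ (m + 1) + x)"] by simp
  also have "\<dots> = (\<Sum>k<b. \<Sum>r<b ^ m. f (real k / real b ^ (m + 1) + real r / real b ^ m))"
    by (rule sum.reindex_bij_betw[OF digit_bij])
  also have "\<dots> = (\<Sum>r<b ^ m. \<Sum>k<b. f (real (r * b + k) / real b ^ Suc m))"
    using base by (subst sum.swap) (simp add: field_simps)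
  also have "\<dots> = (\<Sum>r<b ^ Suc m. f (real r / real b ^ Suc m))"
    by (simp add: shift mult.commute[of b] flip: sum.nat_group)
  finally show ?case .
qed

lemma local_disc_block:
  "local_disc s {a * b ^ m..<Suc a * b ^ m} = lattice_disc (b ^ m) (s (a * b ^ m))"
proof
  fix t
  let ?c = "s (a * b ^ m)"
  have "local_disc s {a * b ^ m..<Suc a * b ^ m} t = (\<Sum>i<b ^ m. of_bool (s (a * b ^ m + i) \<le> t) - t)"
    using sum.shift_bounds_nat_ivl[of "\<lambda>i. of_bool (s i \<le> t) - t" 0 "a * b ^ m" "b ^ m"]
    by (simp add: local_disc_def atLeast0LessThan add.commute)
  also have "\<dots> = (\<Sum>i<b ^ m. of_bool (?c + s i \<le> t) - t)"
    by (intro sum.cong) (auto simp: block_translate)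
  also have "\<dots> = lattice_disc (b ^ m) ?c t"
    using sum_initial_block[of "\<lambda>x. of_bool (?c + x \<le> t) - t" m] by (simp add: lattice_disc_def)
  finally show "local_disc s {a * b ^ m..<Suc a * b ^ m} t = lattice_disc (b ^ m) ?c t" .
qed

lemma wave_block: "wave (local_disc s {a * b ^ m..<Suc a * b ^ m})"
  unfolding local_disc_block using base block_start_bounds[of a m] by (intro wave_lattice_disc) auto

lemma wave_sum_concat:
  assumes "wave_sum k (local_disc s {x..<y})" "wave_sum l (local_disc s {y..<z})" "x \<le> y" "y \<le> z"
  shows "wave_sum (k + l) (local_disc s {x..<z})"
proof -
  have "local_disc s {x..<z} = (\<lambda>t. local_disc s {x..<y} t + local_disc s {y..<z} t)"
    using assms(3,4) by (simp add: fun_eq_iff local_disc_def sum.atLeastLessThan_concat)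
  with wave_sum_add[OF assms(1,2)] show ?thesis by simp
qed

lemma wave_sum_empty: "wave_sum 0 (local_disc s {x..<x})"
  using wave_sum_0 by (simp add: local_disc_def[abs_def])

lemma wave_sum_blocks: "wave_sum k (local_disc s {a * b ^ m..<(a + k) * b ^ m})"
proof (induction k)
  case 0
  show ?case using wave_sum_empty by simp
next
  case (Suc k)
  from wave_sum_concat[OF Suc wave_imp_wave_sum[OF wave_block]] show ?case by simp
qed

text \<open>
  Starting at a multiple of \<open>b ^ m\<close>, the larger blocks are laid out first; then every block begins at a multiple
  of its length.
\<close>

lemma wave_sum_upwards:
  assumes "b ^ m dvd x"
  shows "wave_sum (\<Sum>j<m. \<epsilon> j) (local_disc s {x..<x + (\<Sum>j<m. \<epsilon> j * b ^ j)})"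
  using assms
proof (induction m arbitrary: x)
  case 0
  show ?case using wave_sum_empty by simp
next
  case (Suc m)
  obtain a where x: "x = a * b ^ m" using Suc.prems by (metis dvdE dvd_mult_left mult.commute power_Suc)
  define y where "y = (a + \<epsilon> m) * b ^ m"
  have "wave_sum (\<epsilon> m) (local_disc s {x..<y})"
    unfolding x y_def by (rule wave_sum_blocks)
  moreover have "wave_sum (\<Sum>j<m. \<epsilon> j) (local_disc s {y..<y + (\<Sum>j<m. \<epsilon> j * b ^ j)})"
    by (rule Suc.IH) (simp add: y_def)
  ultimately have "wave_sum (\<epsilon> m + (\<Sum>j<m. \<epsilon> j)) (local_disc s {x..<y + (\<Sum>j<m. \<epsilon> j * b ^ j)})"
    by (rule wave_sum_concat) (auto simp: x y_def)
  then show ?case by (simp add: x y_def algebra_simps)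
qed

text \<open>
  The mirror image: the interval ends at a multiple of \<open>b ^ m\<close>, and the blocks are laid out downwards from there,
  again the larger ones first.
\<close>

lemma wave_sum_downwards:
  assumes "b ^ m dvd y" "x + (\<Sum>j<m. \<delta> j * b ^ j) = y"
  shows "wave_sum (\<Sum>j<m. \<delta> j) (local_disc s {x..<y})"
  using assms
proof (induction m arbitrary: y)
  case 0
  then show ?case using wave_sum_empty by simp
next
  case (Suc m)
  obtain a where y: "y = a * b ^ m" using Suc.prems(1) by (metis dvdE dvd_mult_left mult.commute power_Suc)
  have "\<delta> m * b ^ m \<le> a * b ^ m" using Suc.prems(2) unfolding y sum.lessThan_Suc by linarith
  then have le: "\<delta> m \<le> a" using base by simp
  define z where "z = (a - \<delta> m) * b ^ m"
  have zy: "z + \<delta> m * b ^ m = y" using le by (simp add: z_def y flip: add_mult_distrib)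
  have "wave_sum (\<Sum>j<m. \<delta> j) (local_disc s {x..<z})"
    using Suc.prems(2) zy by (intro Suc.IH) (auto simp: z_def)
  moreover have "wave_sum (\<delta> m) (local_disc s {z..<y})"
    using wave_sum_blocks[of "\<delta> m" "a - \<delta> m" m] le by (simp add: z_def y)
  ultimately have "wave_sum ((\<Sum>j<m. \<delta> j) + \<delta> m) (local_disc s {x..<y})"
    using Suc.prems(2) zy by (intro wave_sum_concat) auto
  then show ?case by simp
qed

text \<open>
  The two decompositions, by the digits \<open>\<epsilon>\<close> of \<open>N\<close> and by the complementary digits \<open>\<delta>\<close>. The 2 in the
  second count stands for the full block \<open>{..<b ^ Suc n}\<close> and for the single index \<open>N\<close>: the numbers
  \<open>\<delta>\<close> are the digits of \<open>b ^ Suc n - 1 - N\<close>, so that their blocks start at \<open>Suc N\<close>.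
\<close>

lemma wave_sum_initial_segment:
  assumes digits: "\<forall>j\<in>{0..n}. \<epsilon> j \<in> {0..b - 1}" and N: "N = (\<Sum>j=0..n. \<epsilon> j * b ^ j)"
  obtains k where "int k = M_digits b n \<epsilon>" "wave_sum k (local_disc s {..<N})"
proof -
  define \<delta> where "\<delta> j = b - 1 - \<epsilon> j" for j
  have range: "{0..n} = {..<Suc n}" by auto
  have up: "wave_sum (\<Sum>j<Suc n. \<epsilon> j) (local_disc s {..<N})"
    using wave_sum_upwards[of "Suc n" 0 \<epsilon>] by (simp add: N range atLeast0LessThan)
  have eps: "\<epsilon> j + \<delta> j = b - 1" if "j < Suc n" for j
  proof -
    have "\<epsilon> j \<le> b - 1" using digits that by auto
    then show ?thesis unfolding \<delta>_def by linarith
  qed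
  have geometric: "(\<Sum>j<m. (b - 1) * b ^ j) + 1 = b ^ m" for m
  proof (induction m)
    case (Suc m)
    have "b ^ Suc m = (b - 1) * b ^ m + b ^ m" using base by (cases b) auto
    with Suc show ?case by simp
  qed simp
  have "N + (\<Sum>j<Suc n. \<delta> j * b ^ j) = (\<Sum>j<Suc n. (\<epsilon> j + \<delta> j) * b ^ j)"
    by (simp add: N range sum.distrib distrib_right del: sum.lessThan_Suc)
  also have "\<dots> = (\<Sum>j<Suc n. (b - 1) * b ^ j)" by (intro sum.cong) (auto simp: eps)
  finally have complement: "Suc N + (\<Sum>j<Suc n. \<delta> j * b ^ j) = b ^ Suc n"
    using geometric[of "Suc n"] by simp
  have "wave_sum (\<Sum>j<Suc n. \<delta> j) (local_disc s {Suc N..<b ^ Suc n})"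
    by (rule wave_sum_downwards[OF _ complement]) simp
  moreover have "wave_sum 1 (local_disc s {N..<Suc N})"
    using wave_imp_wave_sum[OF wave_block[of N 0]] by simp
  ultimately have "wave_sum (1 + (\<Sum>j<Suc n. \<delta> j)) (local_disc s {N..<b ^ Suc n})"
    using complement by (intro wave_sum_concat[of 1 N "Suc N"]) auto
  moreover have "wave_sum 1 (local_disc s {..<b ^ Suc n})"
    using wave_imp_wave_sum[OF wave_block[of 0 "Suc n"]] by (simp add: atLeast0LessThan)
  ultimately have "wave_sum (1 + (1 + (\<Sum>j<Suc n. \<delta> j)))
      (\<lambda>t. local_disc s {..<b ^ Suc n} t + - local_disc s {N..<b ^ Suc n} t)"
    by (intro wave_sum_add wave_sum_uminus)
  moreover have "local_disc s {..<b ^ Suc n} t + - local_disc s {N..<b ^ Suc n} t = local_disc s {..<N} t" for t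
  proof -
    have "N \<le> b ^ Suc n" using complement by simp
    from sum.atLeastLessThan_concat[of 0 N "b ^ Suc n" "\<lambda>i. of_bool (s i \<le> t) - t", OF _ this]
    show ?thesis by (simp add: local_disc_def atLeast0LessThan)
  qed
  ultimately have down: "wave_sum (2 + (\<Sum>j<Suc n. \<delta> j)) (local_disc s {..<N})"
    by (simp add: numeral_2_eq_2)
  have "(\<Sum>j<Suc n. int (\<epsilon> j)) + (\<Sum>j<Suc n. int (\<delta> j)) = (\<Sum>j<Suc n. int b - 1)"
    unfolding sum.distrib[symmetric]
  proof (intro sum.cong refl)
    fix j assume "j \<in> {..<Suc n}"
    then show "int (\<epsilon> j) + int (\<delta> j) = int b - 1" using eps[of j] base by auto
  qed
  also have "\<dots> = int b * (int n + 1) - (int n + 1)" by (simp add: algebra_simps)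
  finally have "M_digits b n \<epsilon> = min (int (\<Sum>j<Suc n. \<epsilon> j)) (int (2 + (\<Sum>j<Suc n. \<delta> j)))"
    by (simp add: M_digits_def range del: sum.lessThan_Suc)
  then have "M_digits b n \<epsilon> = int (\<Sum>j<Suc n. \<epsilon> j) \<or> M_digits b n \<epsilon> = int (2 + (\<Sum>j<Suc n. \<delta> j))"
    by linarith
  with up down that show thesis by metis
qed

end

lemma S_box_sequence_digits:
  assumes "b > 1" "S_box_sequence b s"
  obtains \<sigma> where "digit_permuted_sequence b s \<sigma>"
proof -
  obtain H :: "nat \<Rightarrow> nat" and \<pi> :: "nat \<Rightarrow> nat \<Rightarrow> nat" where
    H: "bij_betw H {1..b - 1} {1..b - 1}" and \<pi>: "\<And>m. \<pi> m permutes {1..b - 1}"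
    and start: "s 0 = 0"
    and step: "\<And>m k i. k \<in> {1..b - 1} \<Longrightarrow> i < b ^ m \<Longrightarrow>
      s (k * b ^ m + i) = real (H (\<pi> m k)) / real b ^ (m + 1) + s i"
    using assms(2) unfolding S_box_sequence_def by blast
  \<comment> \<open>Outside the range of \<open>H\<close>, only the digit 0 matters, which has to be fixed.\<close>
  define \<sigma> where "\<sigma> m k = (if k \<in> {1..b - 1} then H (\<pi> m k) else id k)" for m k
  have "bij_betw (\<sigma> m) {..<b} {..<b}" for m
  proof -
    have "bij_betw (\<lambda>k. H (\<pi> m k)) {1..b - 1} {1..b - 1}"
      using bij_betw_trans[OF permutes_imp_bij[OF \<pi>] H] by (simp add: o_def)
    then have "bij_betw (\<sigma> m) ({1..b - 1} \<union> {0}) ({1..b - 1} \<union> {0})"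
      unfolding \<sigma>_def by (intro bij_betw_disjoint_Un) auto
    moreover have "{1..b - 1} \<union> {0} = {..<b}" using assms(1) by auto
    ultimately show ?thesis by simp
  qed
  moreover have "s (k * b ^ m + i) = real (\<sigma> m k) / real b ^ (m + 1) + s i"
    if "k < b" "i < b ^ m" for k m i
    using step[of k i m] that by (cases "k = 0") (auto simp: \<sigma>_def)
  ultimately have "digit_permuted_sequence b s \<sigma>"
    using assms(1) start by (intro digit_permuted_sequence.intro)
  with that show thesis by blast
qed

section \<open>From waves to discrepancies\<close>

lemma size_initial_segment [simp]: "size (initial_segment s N) = N"
  by (simp add: initial_segment_def)

lemma sum_initial_segment: "(\<Sum>x\<in>#initial_segment s N. f x) = (\<Sum>i<N. f (s i))"
  by (simp add: initial_segment_def sum_unfold_sum_mset image_mset.compositionality o_def)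

lemma discrepancy_initial_segment:
  assumes "range s \<subseteq> {0..}"
  shows "discrepancy p (initial_segment s N) =
    1 / real N powr p * (LINT t:{0..1}|lborel. \<bar>local_disc s {..<N} t\<bar> powr p)"
proof -
  have "(LINT t:{0..1}|lborel. \<bar>(\<Sum>i<N. indicator {0..<t} (s i)) - real N * t\<bar> powr p)
      = (LINT t:{0..1}|lborel. \<bar>local_disc s {..<N} t\<bar> powr p)"
  proof (rule set_lebesgue_integral_cong_AE)
    have "indicator {0..<t} (s i) = (of_bool (s i < t) :: real)" for t i
      using assms by (auto simp: indicator_def)
    then show "(\<lambda>t. \<bar>(\<Sum>i<N. indicator {0..<t} (s i)) - real N * t\<bar> powr p) \<in> borel_measurable lborel"
      by simp
    show "(\<lambda>t. \<bar>local_disc s {..<N} t\<bar> powr p) \<in> borel_measurable lborel"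
      unfolding local_disc_def by simp
    have "AE t in lborel. t \<notin> s ` {..<N}"
      by (intro AE_not_in finite_imp_null_set_lborel) simp
    then show "AE t\<in>{0..1} in lborel. \<bar>(\<Sum>i<N. indicator {0..<t} (s i)) - real N * t\<bar> powr p
        = \<bar>local_disc s {..<N} t\<bar> powr p"
    proof eventually_elim
      case (elim t)
      have "indicator {0..<t} (s i) = (of_bool (s i \<le> t) :: real)" if "i < N" for i
        using elim that assms by (auto simp: indicator_def)
      then show ?case by (simp add: local_disc_def sum_subtractf)
    qed
  qed simp
  then show ?thesis by (simp add: discrepancy_def sum_initial_segment)
qed

lemma discrepancy_sup_initial_segment_le:
  assumes "range s \<subseteq> {0..}" "\<And>t. 0 < t \<Longrightarrow> t < 1 \<Longrightarrow> \<bar>local_disc s {..<N} t\<bar> \<le> C" "N \<ge> 1"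
  shows "real N * discrepancy_sup (initial_segment s N) {{0..t} | t. 0 < t \<and> t < 1} \<le> C"
proof -
  have "(SUP A\<in>{{0..t} | t :: real. 0 < t \<and> t < 1}.
      \<bar>(\<Sum>i<N. indicator A (s i)) - real N * measure lborel A\<bar>) \<le> C"
  proof (rule cSUP_least)
    have "{0..1/2} \<in> {{0..t} | t :: real. 0 < t \<and> t < 1}" by (rule CollectI) (rule exI[of _ "1/2"], simp)
    then show "{{0..t} | t :: real. 0 < t \<and> t < 1} \<noteq> {}" by blast
  next
    fix A assume "A \<in> {{0..t} | t :: real. 0 < t \<and> t < 1}"
    then obtain t where t: "A = {0..t}" "0 < t" "t < 1" by blast
    have "indicator A (s i) = (of_bool (s i \<le> t) :: real)" for i
      using assms(1) by (auto simp: t indicator_def)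
    with assms(2)[OF t(2,3)] t show "\<bar>(\<Sum>i<N. indicator A (s i)) - real N * measure lborel A\<bar> \<le> C"
      by (simp add: local_disc_def sum_subtractf)
  qed
  then show ?thesis using assms(3) by (simp add: discrepancy_sup_def sum_initial_segment)
qed

theorem theorem4:
  fixes b N n :: nat and s :: "nat \<Rightarrow> real" and \<epsilon> :: "nat \<Rightarrow> nat"
  assumes "b > 1"
    and "S_box_sequence b s"
    and "N \<ge> 1"
    and "int n = \<lfloor>ln (real N) / ln (real b)\<rfloor>"
    and "\<forall>j\<in>{0..n}. \<epsilon> j \<in> {0..b - 1}"
    and "N = (\<Sum>j=0..n. \<epsilon> j * b ^ j)"
  shows "(\<forall>p>0. real N * discrepancy p (initial_segment s N) powr (1 / p) \<le>
            (if p < 1 then (real_of_int (M_digits b n \<epsilon>) / (p + 1)) powr (1 / p)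
             else real_of_int (M_digits b n \<epsilon>) / (p + 1) powr (1 / p)))
       \<and> real N * discrepancy_sup (initial_segment s N) {{0..t} | t. 0 < t \<and> t < 1} \<le>
            real_of_int (M_digits b n \<epsilon>)"
proof -
  obtain \<sigma> where "digit_permuted_sequence b s \<sigma>"
    using S_box_sequence_digits[OF assms(1,2)] by blast
  then interpret digit_permuted_sequence b s \<sigma> .
  obtain k where k: "int k = M_digits b n \<epsilon>" and waves: "wave_sum k (local_disc s {..<N})"
    using wave_sum_initial_segment[OF assms(5,6)] by blast
  have M: "real_of_int (M_digits b n \<epsilon>) = real k" by (simp flip: k)
  have nonneg: "range s \<subseteq> {0..}" using block_start_bounds(1)[of _ 0] by auto
  have "real N * discrepancy p (initial_segment s N) powr (1 / p) \<le>
      (if p < 1 then (real k / (p + 1)) powr (1 / p) else real k / (p + 1) powr (1 / p))"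
    if p: "p > 0" for p
  proof -
    define I where "I = (LINT t:{0..1}|lborel. \<bar>local_disc s {..<N} t\<bar> powr p)"
    have "I \<ge> 0" by (simp add: I_def set_lebesgue_integral_def)
    have "real N * discrepancy p (initial_segment s N) powr (1 / p) = I powr (1 / p)"
      using assms(3) p \<open>I \<ge> 0\<close>
      by (simp add: discrepancy_initial_segment[OF nonneg] powr_divide powr_powr flip: I_def)
    also have "\<dots> \<le> (if p < 1 then (real k / (p + 1)) powr (1 / p) else real k / (p + 1) powr (1 / p))"
    proof (cases "p < 1")
      case True
      then have "I \<le> real k / (p + 1)"
        unfolding I_def using wave_sum_integral_concave[OF waves] p by simp
      with True \<open>I \<ge> 0\<close> p show ?thesis by (simp add: powr_mono2)
    next
      case False
      then have "I \<le> real k powr p / (p + 1)"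
        unfolding I_def using wave_sum_integral_convex[OF waves] by simp
      then have "I powr (1 / p) \<le> (real k powr p / (p + 1)) powr (1 / p)"
        using \<open>I \<ge> 0\<close> p by (intro powr_mono2) auto
      with False p show ?thesis by (simp add: powr_divide powr_powr)
    qed
    finally show ?thesis .
  qed
  moreover have "real N * discrepancy_sup (initial_segment s N) {{0..t} | t. 0 < t \<and> t < 1} \<le> real k"
    using wave_sum_bound[OF waves] assms(3)
    by (intro discrepancy_sup_initial_segment_le[OF nonneg]) auto
  ultimately show ?thesis unfolding M by blast
qed

end
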